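(* Let $R$ be a commutative ring with identity, $S$ a multiplicative subset of $R$ and $M$ an $R$-module. Let $L$ and $N$ denote arbitrary $R$-modules. Then the following assertions hold. (1) Suppose $M$ is $u$-$S$-torsion and $f:L\to M$ is a $u$-$S$-monomorphism. Then $L$ is $u$-$S$-torsion. (2) Suppose $M$ is $u$-$S$-torsion and $g:M\to N$ is a $u$-$S$-epimorphism. Then $N$ is $u$-$S$-torsion. (3) Let $f:M\to N$ be a $u$-$S$-isomorphism. If one of $M$ and $N$ is $u$-$S$-torsion, so is the other. (4) Let $0\to L\xrightarrow{f}M\xrightarrow{g}N\to 0$ be a $u$-$S$-exact sequence. Then $M$ is $u$-$S$-torsion if and only if $L$ and $N$ are $u$-$S$-torsion.
   Context: A multiplicative subset $S$ of $R$ is a subset with $1\in S$ and $s_1s_2\in S$ for all $s_1,s_2\in S$. An $R$-module $T$ is $u$-$S$-torsion if there exists $s\in S$ with $sT=0$. An $R$-homomorphism $f$ is a $u$-$S$-monomorphism (resp., $u$-$S$-epimorphism) if $\mathrm{Ker}(f)$ (resp., $\mathrm{Coker}(f)$) is $u$-$S$-torsion, and a $u$-$S$-isomorphism if it is both a $u$-$S$-monomorphism and a $u$-$S$-epimorphism. A sequence of $R$-modules $M\xrightarrow{f}N\xrightarrow{g}L$ is $u$-$S$-exact (at $N$) if there is $s\in S$ with $s\,\mathrm{Ker}(g)\subseteq \mathrm{Im}(f)$ and $s\,\mathrm{Im}(f)\subseteq \mathrm{Ker}(g)$. A sequence $0\to A\to B\to C\to 0$ is $u$-$S$-exact if it is $u$-$S$-exact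 at each of $A,B,C$. *)

theory Defs
  imports "HOL-Algebra.Module" "HOL-Algebra.AbelCoset"
begin

definition mod_hom ::
  "('r, 'm) ring_scheme \<Rightarrow> ('r, 'a, 'p) module_scheme \<Rightarrow> ('r, 'b, 'q) module_scheme \<Rightarrow> ('a \<Rightarrow> 'b) set"
  where "mod_hom R M N =
    {f \<in> hom (add_monoid M) (add_monoid N).
      \<forall>a\<in>carrier R. \<forall>x\<in>carrier M. f (a \<odot>\<^bsub>M\<^esub> x) = a \<odot>\<^bsub>N\<^esub> f x}"

text \<open>The record type of modules extends that of rings. The axioms of the locale
  \<^locale>\<open>module\<close> do not mention the fields \<open>mult\<close> and \<open>one\<close>, so these are left unspecified
  in the modules constructed here.\<close>

definition zero_module :: "('r, unit) module"
  where "zero_module =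
    \<lparr>carrier = {()}, mult = undefined, one = undefined,
     zero = (), add = (\<lambda>_ _. ()), smult = (\<lambda>_ _. ())\<rparr>"

text \<open>For \<open>X = H + x\<close>, all the cosets in the union defining scalar multiplication
  coincide with \<open>H + a x\<close>; see \<open>quotient_smult_coset\<close> below.\<close>

definition quotient_module ::
  "('r, 'a, 'p) module_scheme \<Rightarrow> 'a set \<Rightarrow> ('r, 'a set) module"
  where "quotient_module M H =
    \<lparr>carrier = a_rcosets\<^bsub>M\<^esub> H, mult = undefined, one = undefined,
     zero = H, add = set_add M,
     smult = (\<lambda>a X. \<Union>x\<in>X. H +>\<^bsub>M\<^esub> (a \<odot>\<^bsub>M\<^esub> x))\<rparr>"

definition ker_module ::
  "('r, 'a, 'p) module_scheme \<Rightarrow> ('r, 'b, 'q) module_scheme \<Rightarrow> ('a \<Rightarrow> 'b) \<Rightarrow> ('r, 'a, 'p) module_scheme"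
  where "ker_module M N f = M\<lparr>carrier := a_kernel M N f\<rparr>"

definition coker_module ::
  "('r, 'a, 'p) module_scheme \<Rightarrow> ('r, 'b, 'q) module_scheme \<Rightarrow> ('a \<Rightarrow> 'b) \<Rightarrow> ('r, 'b set) module"
  where "coker_module M N f = quotient_module N (f ` carrier M)"

definition uS_torsion :: "'r set \<Rightarrow> ('r, 'a, 'p) module_scheme \<Rightarrow> bool"
  where "uS_torsion S T \<longleftrightarrow> (\<exists>s\<in>S. (\<lambda>t. s \<odot>\<^bsub>T\<^esub> t) ` carrier T = {\<zero>\<^bsub>T\<^esub>})"

definition uS_monomorphism ::
  "('r, 'm) ring_scheme \<Rightarrow> 'r set \<Rightarrow> ('r, 'a, 'p) module_scheme \<Rightarrow> ('r, 'b, 'q) module_scheme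
    \<Rightarrow> ('a \<Rightarrow> 'b) \<Rightarrow> bool"
  where "uS_monomorphism R S M N f \<longleftrightarrow> f \<in> mod_hom R M N \<and> uS_torsion S (ker_module M N f)"

definition uS_epimorphism ::
  "('r, 'm) ring_scheme \<Rightarrow> 'r set \<Rightarrow> ('r, 'a, 'p) module_scheme \<Rightarrow> ('r, 'b, 'q) module_scheme
    \<Rightarrow> ('a \<Rightarrow> 'b) \<Rightarrow> bool"
  where "uS_epimorphism R S M N f \<longleftrightarrow> f \<in> mod_hom R M N \<and> uS_torsion S (coker_module M N f)"

definition uS_isomorphism ::
  "('r, 'm) ring_scheme \<Rightarrow> 'r set \<Rightarrow> ('r, 'a, 'p) module_scheme \<Rightarrow> ('r, 'b, 'q) module_scheme
    \<Rightarrow> ('a \<Rightarrow> 'b) \<Rightarrow> bool"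
  where "uS_isomorphism R S M N f \<longleftrightarrow> uS_monomorphism R S M N f \<and> uS_epimorphism R S M N f"

definition uS_exact ::
  "('r, 'm) ring_scheme \<Rightarrow> 'r set \<Rightarrow> ('r, 'a, 'p) module_scheme \<Rightarrow> ('r, 'b, 'q) module_scheme
    \<Rightarrow> ('r, 'c, 't) module_scheme \<Rightarrow> ('a \<Rightarrow> 'b) \<Rightarrow> ('b \<Rightarrow> 'c) \<Rightarrow> bool"
  where "uS_exact R S M N L f g \<longleftrightarrow>
    f \<in> mod_hom R M N \<and> g \<in> mod_hom R N L \<and>
    (\<exists>s\<in>S. (\<lambda>x. s \<odot>\<^bsub>N\<^esub> x) ` a_kernel N L g \<subseteq> f ` carrier M \<and>
            (\<lambda>x. s \<odot>\<^bsub>N\<^esub> x) ` (f ` carrier M) \<subseteq> a_kernel N L g)"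

definition uS_short_exact ::
  "('r, 'm) ring_scheme \<Rightarrow> 'r set \<Rightarrow> ('r, 'a, 'p) module_scheme \<Rightarrow> ('r, 'b, 'q) module_scheme
    \<Rightarrow> ('r, 'c, 't) module_scheme \<Rightarrow> ('a \<Rightarrow> 'b) \<Rightarrow> ('b \<Rightarrow> 'c) \<Rightarrow> bool"
  where "uS_short_exact R S A B C f g \<longleftrightarrow>
    uS_exact R S zero_module A B (\<lambda>_. \<zero>\<^bsub>A\<^esub>) f \<and>
    uS_exact R S A B C f g \<and>
    uS_exact R S B C zero_module g (\<lambda>_. ())"

lemma zero_module_is_module:
  assumes "cring R"
  shows "module R zero_module"
proof (rule moduleI[OF assms])
  show "abelian_group zero_module"
    by (rule abelian_groupI) (simp_all add: zero_module_def)
qed (simp_all add: zero_module_def)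

lemma quotient_smult_coset:
  assumes "module R M" "submodule H R M" "a \<in> carrier R" "x \<in> carrier M"
  shows "a \<odot>\<^bsub>quotient_module M H\<^esub> (H +>\<^bsub>M\<^esub> x) = H +>\<^bsub>M\<^esub> (a \<odot>\<^bsub>M\<^esub> x)"
proof -
  interpret module R M by fact
  interpret H: submodule H R M by fact
  interpret abelian_subgroup H M
    using H.subgroup_axioms by (intro abelian_subgroupI3 additive_subgroup.intro abelian_group_axioms)
  have *: "H +>\<^bsub>M\<^esub> (a \<odot>\<^bsub>M\<^esub> y) = H +>\<^bsub>M\<^esub> (a \<odot>\<^bsub>M\<^esub> x)" if y: "y \<in> H +>\<^bsub>M\<^esub> x" for y
  proof -
    from y obtain h where h: "h \<in> H" "y = h \<oplus>\<^bsub>M\<^esub> x"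
      by (auto simp: a_r_coset_def')
    then have "a \<odot>\<^bsub>M\<^esub> y \<in> H +>\<^bsub>M\<^esub> (a \<odot>\<^bsub>M\<^esub> x)"
      using assms(3,4) H.smult_closed[of a h] a_Hcarr
      by (auto simp: a_r_coset_def' smult_r_distr)
    then show ?thesis
      using a_repr_independence assms(3,4) a_subgroup smult_closed by metis
  qed
  have "x \<in> H +>\<^bsub>M\<^esub> x" using assms(4) by (rule a_rcos_self)
  with * have "(\<Union>y\<in>H +>\<^bsub>M\<^esub> x. H +>\<^bsub>M\<^esub> (a \<odot>\<^bsub>M\<^esub> y)) = H +>\<^bsub>M\<^esub> (a \<odot>\<^bsub>M\<^esub> x)"
    by blast
  then show ?thesis by (simp add: quotient_module_def)
qed

lemma quotient_module_is_module:
  assumes "module R M" "submodule H R M"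
  shows "module R (quotient_module M H)"
proof -
  interpret module R M by fact
  interpret H: submodule H R M by fact
  interpret abelian_subgroup H M
    using H.subgroup_axioms by (intro abelian_subgroupI3 additive_subgroup.intro abelian_group_axioms)
  let ?Q = "quotient_module M H"
  have sm: "a \<odot>\<^bsub>?Q\<^esub> (H +>\<^bsub>M\<^esub> x) = H +>\<^bsub>M\<^esub> (a \<odot>\<^bsub>M\<^esub> x)"
    if "a \<in> carrier R" "x \<in> carrier M" for a x
    using quotient_smult_coset[OF assms that] .
  have ad: "(H +>\<^bsub>M\<^esub> x) \<oplus>\<^bsub>?Q\<^esub> (H +>\<^bsub>M\<^esub> y) = H +>\<^bsub>M\<^esub> (x \<oplus>\<^bsub>M\<^esub> y)"
    if "x \<in> carrier M" "y \<in> carrier M" for x y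
    using a_rcos_sum[OF that] by (simp add: quotient_module_def)
  have ze: "\<zero>\<^bsub>?Q\<^esub> = H +>\<^bsub>M\<^esub> \<zero>\<^bsub>M\<^esub>"
    using a_coset_add_zero[OF a_subset] by (simp add: quotient_module_def)
  have ca: "carrier ?Q = (\<lambda>x. H +>\<^bsub>M\<^esub> x) ` carrier M"
    by (auto simp: quotient_module_def A_RCOSETS_def')
  have "abelian_group ?Q"
  proof (rule abelian_groupI)
    show "\<exists>y\<in>carrier ?Q. y \<oplus>\<^bsub>?Q\<^esub> x = \<zero>\<^bsub>?Q\<^esub>" if "x \<in> carrier ?Q" for x
    proof -
      from that obtain z where z: "z \<in> carrier M" "x = H +>\<^bsub>M\<^esub> z" by (auto simp: ca)
      then have "(H +>\<^bsub>M\<^esub> (\<ominus>\<^bsub>M\<^esub> z)) \<oplus>\<^bsub>?Q\<^esub> x = \<zero>\<^bsub>?Q\<^esub>"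
        by (simp add: ad ze M.l_neg)
      moreover have "H +>\<^bsub>M\<^esub> (\<ominus>\<^bsub>M\<^esub> z) \<in> carrier ?Q"
        using z by (simp add: ca)
      ultimately show ?thesis by blast
    qed
    show "x \<oplus>\<^bsub>?Q\<^esub> y = y \<oplus>\<^bsub>?Q\<^esub> x" if "x \<in> carrier ?Q" "y \<in> carrier ?Q" for x y
    proof -
      from that obtain u v where "u \<in> carrier M" "x = H +>\<^bsub>M\<^esub> u" "v \<in> carrier M" "y = H +>\<^bsub>M\<^esub> v"
        by (auto simp: ca)
      then show ?thesis by (simp add: ad M.a_comm[of u v])
    qed
  qed (auto simp: ca ze ad M.a_assoc)
  then show ?thesis
    by (rule moduleI[OF is_cring])
      (auto simp: ca sm ad smult_l_distr smult_r_distr smult_assoc1)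
qed

end

theory Submission
  imports Defs
begin

text \<open>All four assertions are instances of one fact: in a \<open>u\<close>-\<open>S\<close>-exact sequence
  \<open>A \<rightarrow> B \<rightarrow> C\<close> whose outer modules are \<open>u\<close>-\<open>S\<close>-torsion, the middle module is
  \<open>u\<close>-\<open>S\<close>-torsion (\<open>uS_torsion_middle\<close>).  If \<open>t\<close> kills \<open>C\<close>, then \<open>t\<close> sends \<open>B\<close> into
  the kernel; if \<open>s\<close> witnesses exactness, then \<open>s t\<close> sends \<open>B\<close> into the image of
  \<open>A\<close>; if \<open>u\<close> kills \<open>A\<close>, it kills that image, so \<open>u s t \<in> S\<close> kills \<open>B\<close>.

  The zero module is \<open>u\<close>-\<open>S\<close>-torsion, so it may stand at either end.  A
  \<open>u\<close>-\<open>S\<close>-monomorphism \<open>A \<rightarrow> B\<close> makes \<open>0 \<rightarrow> A \<rightarrow> B\<close> exact at \<open>A\<close>, and a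
  \<open>u\<close>-\<open>S\<close>-epimorphism makes \<open>A \<rightarrow> B \<rightarrow> 0\<close> exact at \<open>B\<close>; this gives the assertions about
  single homomorphisms.  In a short exact sequence, exactness at the two ends passes torsion
  from the middle module outwards, and exactness in the middle passes it back.\<close>

lemma mod_homD:
  assumes "f \<in> mod_hom R M N"
  shows "x \<in> carrier M \<Longrightarrow> f x \<in> carrier N"
    and "a \<in> carrier R \<Longrightarrow> x \<in> carrier M \<Longrightarrow> f (a \<odot>\<^bsub>M\<^esub> x) = a \<odot>\<^bsub>N\<^esub> f x"
  using assms by (auto simp: mod_hom_def hom_def)

lemma mod_hom_group_hom:
  assumes "module R M" "module R N" "f \<in> mod_hom R M N"
  shows "group_hom (add_monoid M) (add_monoid N) f"
proof -
  interpret M: module R M by fact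
  interpret N: module R N by fact
  show ?thesis
    using assms(3)
    by (intro group_hom.intro M.a_group N.a_group group_hom_axioms.intro) (simp add: mod_hom_def)
qed

lemma mod_hom_zero:
  assumes "module R M" "module R N" "f \<in> mod_hom R M N"
  shows "f \<zero>\<^bsub>M\<^esub> = \<zero>\<^bsub>N\<^esub>"
  using group_hom.hom_one[OF mod_hom_group_hom[OF assms]] by simp

lemma mem_a_kernel_iff: "x \<in> a_kernel M N f \<longleftrightarrow> x \<in> carrier M \<and> f x = \<zero>\<^bsub>N\<^esub>"
  by (auto simp: a_kernel_def')

lemma image_submodule:
  assumes "module R M" "module R N" "f \<in> mod_hom R M N"
  shows "submodule (f ` carrier M) R N"
proof -
  interpret M: module R M by fact
  have "subgroup (f ` carrier M) (add_monoid N)"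
    using group_hom.img_is_subgroup[OF mod_hom_group_hom[OF assms]] by simp
  moreover have "a \<odot>\<^bsub>N\<^esub> y \<in> f ` carrier M" if "a \<in> carrier R" "y \<in> f ` carrier M" for a y
    using that by (auto simp flip: mod_homD(2)[OF assms(3)])
  ultimately show ?thesis
    by (simp add: submodule_def submodule_axioms_def)
qed

text \<open>Torsion is defined by an equality of sets, \<open>s T = {0}\<close>.  Its nontrivial inclusion is
  enough, because \<open>T\<close> is nonempty.\<close>

lemma uS_torsion_iff:
  assumes "module R T"
  shows "uS_torsion S T \<longleftrightarrow> (\<exists>s\<in>S. \<forall>t\<in>carrier T. s \<odot>\<^bsub>T\<^esub> t = \<zero>\<^bsub>T\<^esub>)"
proof -
  interpret module R T by fact
  have "carrier T \<noteq> {}" using M.zero_closed by blast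
  then have "(\<lambda>t. s \<odot>\<^bsub>T\<^esub> t) ` carrier T = {\<zero>\<^bsub>T\<^esub>} \<longleftrightarrow> (\<forall>t\<in>carrier T. s \<odot>\<^bsub>T\<^esub> t = \<zero>\<^bsub>T\<^esub>)" for s
    by (auto simp: image_constant_conv cong: image_cong)
  then show ?thesis by (simp add: uS_torsion_def)
qed

lemma uS_torsion_zero_module:
  assumes "submonoid S R"
  shows "uS_torsion S zero_module"
  using submonoid.one_closed[OF assms] by (auto simp: uS_torsion_def zero_module_def)

lemma uS_torsion_middle:
  assumes S: "submonoid S R"
    and A: "module R A" and B: "module R B" and C: "module R C"
    and exact: "uS_exact R S A B C f g"
    and tors: "uS_torsion S A" "uS_torsion S C"
  shows "uS_torsion S B"
proof -
  interpret S: submonoid S R by fact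
  interpret B: module R B by fact
  from exact have f: "f \<in> mod_hom R A B" and g: "g \<in> mod_hom R B C"
    by (simp_all add: uS_exact_def)
  from exact obtain s where s: "s \<in> S"
    and ker: "(\<lambda>x. s \<odot>\<^bsub>B\<^esub> x) ` a_kernel B C g \<subseteq> f ` carrier A"
    by (auto simp: uS_exact_def)
  obtain u where u: "u \<in> S" "\<forall>x\<in>carrier A. u \<odot>\<^bsub>A\<^esub> x = \<zero>\<^bsub>A\<^esub>"
    using tors(1) uS_torsion_iff[OF A] by blast
  obtain t where t: "t \<in> S" "\<forall>z\<in>carrier C. t \<odot>\<^bsub>C\<^esub> z = \<zero>\<^bsub>C\<^esub>"
    using tors(2) uS_torsion_iff[OF C] by blast
  have carr: "u \<in> carrier R" "s \<in> carrier R" "t \<in> carrier R"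
    using u(1) s t(1) S.subset by auto
  have "(u \<otimes>\<^bsub>R\<^esub> (s \<otimes>\<^bsub>R\<^esub> t)) \<odot>\<^bsub>B\<^esub> y = \<zero>\<^bsub>B\<^esub>" if y: "y \<in> carrier B" for y
  proof -
    have "t \<odot>\<^bsub>B\<^esub> y \<in> a_kernel B C g"
      using mod_homD[OF g] t(2) carr y by (simp add: mem_a_kernel_iff)
    then have "s \<odot>\<^bsub>B\<^esub> (t \<odot>\<^bsub>B\<^esub> y) \<in> f ` carrier A"
      using ker by blast
    then obtain x where x: "x \<in> carrier A" "s \<odot>\<^bsub>B\<^esub> (t \<odot>\<^bsub>B\<^esub> y) = f x"
      by auto
    have "u \<odot>\<^bsub>B\<^esub> f x = f (u \<odot>\<^bsub>A\<^esub> x)"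
      using mod_homD(2)[OF f] carr x(1) by simp
    also have "\<dots> = \<zero>\<^bsub>B\<^esub>"
      using u(2) x(1) mod_hom_zero[OF A B f] by simp
    finally show ?thesis
      using carr y x(2) by (simp add: B.smult_assoc1)
  qed
  moreover have "u \<otimes>\<^bsub>R\<^esub> (s \<otimes>\<^bsub>R\<^esub> t) \<in> S"
    using u(1) s t(1) by simp
  ultimately show ?thesis
    using uS_torsion_iff[OF B] by blast
qed

text \<open>An element of \<open>S\<close> that kills the kernel sends it into the image of \<open>0\<close>.\<close>

lemma uS_monomorphism_imp_exact:
  assumes S: "submonoid S R" and A: "module R A" and B: "module R B"
    and f: "uS_monomorphism R S A B f"
  shows "uS_exact R S zero_module A B (\<lambda>_. \<zero>\<^bsub>A\<^esub>) f"
proof -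
  interpret A: module R A by fact
  from f have hom: "f \<in> mod_hom R A B" by (simp add: uS_monomorphism_def)
  from f have "\<exists>s\<in>S. (\<lambda>x. s \<odot>\<^bsub>A\<^esub> x) ` a_kernel A B f = {\<zero>\<^bsub>A\<^esub>}"
    by (simp add: uS_monomorphism_def uS_torsion_def ker_module_def)
  then obtain s where s: "s \<in> S" "(\<lambda>x. s \<odot>\<^bsub>A\<^esub> x) ` a_kernel A B f = {\<zero>\<^bsub>A\<^esub>}"
    by blast
  have "(\<lambda>_. \<zero>\<^bsub>A\<^esub>) \<in> mod_hom R zero_module A"
    by (auto simp: mod_hom_def hom_def zero_module_def)
  moreover have "s \<odot>\<^bsub>A\<^esub> \<zero>\<^bsub>A\<^esub> \<in> a_kernel A B f"
    using s(1) submonoid.subset[OF S] mod_hom_zero[OF A B hom]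
    by (auto simp: mem_a_kernel_iff)
  ultimately show ?thesis
    unfolding uS_exact_def using hom s by (auto simp: zero_module_def)
qed

text \<open>To say that \<open>s\<close> kills every coset of the image is to say that \<open>s\<close> sends \<open>B\<close>, the
  kernel of the map to \<open>0\<close>, into the image.\<close>

lemma uS_epimorphism_imp_exact:
  assumes S: "submonoid S R" and A: "module R A" and B: "module R B"
    and f: "uS_epimorphism R S A B f"
  shows "uS_exact R S A B zero_module f (\<lambda>_. ())"
proof -
  interpret B: module R B by fact
  let ?H = "f ` carrier A"
  from f have hom: "f \<in> mod_hom R A B" by (simp add: uS_epimorphism_def)
  interpret H: submodule ?H R B by (rule image_submodule[OF A B hom])
  interpret abelian_subgroup ?H B
    using H.subgroup_axioms
    by (intro abelian_subgroupI3 additive_subgroup.intro B.abelian_group_axioms)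
  have "carrier (quotient_module B ?H) = a_rcosets\<^bsub>B\<^esub> ?H" "\<zero>\<^bsub>quotient_module B ?H\<^esub> = ?H"
    by (simp_all add: quotient_module_def)
  with f have "\<exists>s\<in>S. (\<lambda>X. s \<odot>\<^bsub>quotient_module B ?H\<^esub> X) ` (a_rcosets\<^bsub>B\<^esub> ?H) = {?H}"
    by (simp add: uS_epimorphism_def uS_torsion_def coker_module_def)
  then obtain s where s: "s \<in> S"
    and kill: "(\<lambda>X. s \<odot>\<^bsub>quotient_module B ?H\<^esub> X) ` (a_rcosets\<^bsub>B\<^esub> ?H) = {?H}"
    by blast
  have sR: "s \<in> carrier R" using s submonoid.subset[OF S] by blast
  have "s \<odot>\<^bsub>B\<^esub> y \<in> ?H" if y: "y \<in> carrier B" for y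
  proof -
    have "?H +>\<^bsub>B\<^esub> y \<in> a_rcosets\<^bsub>B\<^esub> ?H"
      using y by (auto simp: A_RCOSETS_def')
    then have "s \<odot>\<^bsub>quotient_module B ?H\<^esub> (?H +>\<^bsub>B\<^esub> y) = ?H"
      using kill by blast
    then have "?H +>\<^bsub>B\<^esub> (s \<odot>\<^bsub>B\<^esub> y) = ?H"
      using quotient_smult_coset[OF B H.submodule_axioms sR y] by simp
    then show ?thesis
      using a_rcos_self[of "s \<odot>\<^bsub>B\<^esub> y"] sR y by simp
  qed
  moreover have "(\<lambda>_. ()) \<in> mod_hom R B zero_module"
    by (auto simp: mod_hom_def hom_def zero_module_def)
  ultimately show ?thesis
    unfolding uS_exact_def using hom s sR mod_homD(1)[OF hom]
    by (intro conjI bexI[of _ s]) (auto simp: mem_a_kernel_iff zero_module_def)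
qed

theorem proposition2p8:
  fixes R :: "('r, 'm) ring_scheme"
    and S :: "'r set"
    and M :: "('r, 'a, 'p) module_scheme"
    and L :: "('r, 'b, 'q) module_scheme"
    and N :: "('r, 'c, 't) module_scheme"
  assumes "cring R"
    and "submonoid S R"
    and "module R M"
    and "module R L"
    and "module R N"
  shows "(uS_torsion S M \<longrightarrow> (\<forall>f. uS_monomorphism R S L M f \<longrightarrow> uS_torsion S L))
    \<and> (uS_torsion S M \<longrightarrow> (\<forall>g. uS_epimorphism R S M N g \<longrightarrow> uS_torsion S N))
    \<and> (\<forall>f. uS_isomorphism R S M N f \<longrightarrow> (uS_torsion S M \<longleftrightarrow> uS_torsion S N))
    \<and> (\<forall>f g. uS_short_exact R S L M N f g \<longrightarrow>
          (uS_torsion S M \<longleftrightarrow> uS_torsion S L \<and> uS_torsion S N))"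
proof -
  note S = assms(2) and M = assms(3) and L = assms(4) and N = assms(5)
  note Z = zero_module_is_module[OF assms(1)] and Z_torsion = uS_torsion_zero_module[OF S]
  have mono: "uS_torsion S L"
    if "uS_torsion S M" "uS_monomorphism R S L M f" for f
    using uS_torsion_middle[OF S Z L M uS_monomorphism_imp_exact[OF S L M that(2)]]
      Z_torsion that(1) by blast
  have epi: "uS_torsion S N"
    if "uS_torsion S M" "uS_epimorphism R S M N g" for g
    using uS_torsion_middle[OF S M N Z uS_epimorphism_imp_exact[OF S M N that(2)]]
      Z_torsion that(1) by blast
  have iso: "uS_torsion S M \<longleftrightarrow> uS_torsion S N" if f: "uS_isomorphism R S M N f" for f
  proof
    show "uS_torsion S N" if "uS_torsion S M"
      using epi that f by (auto simp: uS_isomorphism_def)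
    show "uS_torsion S M" if "uS_torsion S N"
      using uS_torsion_middle[OF S Z M N uS_monomorphism_imp_exact[OF S M N]]
        Z_torsion that f by (auto simp: uS_isomorphism_def)
  qed
  have ses: "uS_torsion S M \<longleftrightarrow> uS_torsion S L \<and> uS_torsion S N"
    if "uS_short_exact R S L M N f g" for f g
  proof -
    from that have at_L: "uS_exact R S zero_module L M (\<lambda>_. \<zero>\<^bsub>L\<^esub>) f"
      and at_M: "uS_exact R S L M N f g"
      and at_N: "uS_exact R S M N zero_module g (\<lambda>_. ())"
      by (simp_all add: uS_short_exact_def)
    show ?thesis
      using uS_torsion_middle[OF S Z L M at_L Z_torsion] uS_torsion_middle[OF S L M N at_M]
        uS_torsion_middle[OF S M N Z at_N _ Z_torsion] by blast
  qed
  show ?thesis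
    using mono epi iso ses by blast
qed

end
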